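(* Let $P\subset\mathbb{R}^2$ be a finite set of points and let $N\in\mathbb{N}$. Suppose that $I_c(\nu^n(P))=0$ for all $n=0,1,2,\dots,N-1$. Then $$|\nu^N(P)|\ \ge\ 2^N|P|-(2^N-1)\left(|\mathrm{Bd}(P)|+2\right).$$
   Context: For a finite set $P\subset\mathbb{R}^2$ (the generating set) and $p\in P$, the Voronoi polygon of $p$ is $V(p)=\{x\in\mathbb{R}^2 : \|p-x\|\le\|p'-x\| \text{ for all } p'\in P\}$, and the Voronoi tessellation is $\Upsilon(P)=\{V(p) : p\in P\}$. A point is a Voronoi vertex of $\Upsilon(P)$ if it is the (one-point) intersection of three or more Voronoi polygons of $\Upsilon(P)$. The Voronoi iteration $\nu(P)$ is the (finite) set of all Voronoi vertices of $\Upsilon(P)$ (with $\nu(\emptyset)=\emptyset$), $\nu^0(P)=P$, and $\nu^n(P)=\nu(\nu^{n-1}(P))$ for $n\ge1$. $|\cdot|$ denotes cardinality. $\mathrm{Bd}(P)=P\cap\partial CH(P)$, where $CH(P)$ is the convex hull of $P$ (the smallest convex set containing $P$) and $\partial CH(P)$ is its boundary (so points of $P$ lying in the relative interior of a side of the hull are included in $\mathrm{Bd}(P)$). An empty circle of a finite point set $Q$ is a circle whose interior (open disc) contains no point of $Q$ and which itself passes through three or more points of $Q$. If $C_1,\dots,C_k$ are all the empty circles of $Q$, then the number of instances of cocircularity of $Q$ is $I_c(Q)=\sum_{i=1}^k\left(|C_i\cap Q|-3\right)$ (so $I_c(Q)=0$ if there are no empty circles).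
   Formalization: It is additionally assumed that P is not contained in a line if |P| ≥ 3; for three collinear points and N = 1 the claim fails, since I_c(P) = 0 and ν(P) is empty while the right-hand side is 1. *)

theory Defs
  imports "HOL-Analysis.Analysis"
begin

definition voronoi_polygon :: "(real^2) set \<Rightarrow> real^2 \<Rightarrow> (real^2) set" where
  "voronoi_polygon P p = {x. \<forall>p'\<in>P. norm (p - x) \<le> norm (p' - x)}"

definition voronoi_tessellation :: "(real^2) set \<Rightarrow> (real^2) set set" where
  "voronoi_tessellation P = voronoi_polygon P ` P"

definition voronoi_vertex :: "(real^2) set \<Rightarrow> real^2 \<Rightarrow> bool" where
  "voronoi_vertex P x \<longleftrightarrow>
    (\<exists>S \<subseteq> voronoi_tessellation P. 3 \<le> card S \<and> \<Inter> S = {x})"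

definition voronoi_iteration :: "(real^2) set \<Rightarrow> (real^2) set" where
  "voronoi_iteration P = {x. voronoi_vertex P x}"

text \<open>The frontier is taken in the plane, so a degenerate hull (a point or a segment) is its own
  boundary.\<close>

definition Bd :: "(real^2) set \<Rightarrow> (real^2) set" where
  "Bd P = P \<inter> frontier (convex hull P)"

definition empty_circles :: "(real^2) set \<Rightarrow> (real^2) set set" where
  "empty_circles Q = {C. \<exists>c r. 0 < r \<and> C = sphere c r \<and> ball c r \<inter> Q = {} \<and> 3 \<le> card (C \<inter> Q)}"

text \<open>Every term is a true difference, since an empty circle carries at least three points. For
  finite \<open>Q\<close> the index set is finite, because three points determine a circle.\<close>

definition cocircularity :: "(real^2) set \<Rightarrow> nat" where
  "cocircularity Q = (\<Sum>C\<in>empty_circles Q. card (C \<inter> Q) - 3)"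

end

theory Submission
  imports Defs
begin

text \<open>Write \<open>\<nu>\<close> for \<^const>\<open>voronoi_iteration\<close>, and \<open>n\<close>, \<open>b\<close> for the number of points and of
  boundary points of a set. A Voronoi vertex is the centre of an empty circle, and without
  instances of cocircularity such a circle carries exactly three points: the corners of a Delaunay
  triangle. The theorem follows from three estimates on one step of the iteration.

  The first is \<open>|\<nu>(P)| \<ge> 2n - b - 2\<close> for \<open>P\<close> not collinear (\<open>card_voronoi_iteration_ge\<close>). It
  comes from the Delaunay triangulation having \<open>2n - b - 2\<close> triangles, but neither a tiling nor
  Euler's formula enters. Let \<open>u\<close> be a direction in which all points of \<open>P\<close> have different
  heights. Each triangle has a middle corner with respect to \<open>u\<close>, and the line through it
  perpendicular to \<open>u\<close> enters the triangle on one side. So a triangle is determined by, and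
  determines, a pair of a point and a side of this line. A point off the boundary of the hull
  occurs with both sides and a boundary point with at least one side, unless it is extreme in
  direction \<open>u\<close>. The triangle that a direction \<open>e\<close> enters at \<open>p\<close> is found by linear
  programming (\<open>apex_exists\<close>): its circumcentre maximises \<open>e\<close> over the Voronoi polygon of
  \<open>p\<close>, where duality puts \<open>e\<close> into the cone of the two active constraints.

  The second is \<open>|Bd(\<nu>(P))| \<le> |Bd(P)|\<close> (\<open>card_Bd_voronoi_iteration_le\<close>). The three Voronoi
  edges at a vertex point in directions that positively span the plane. At a boundary vertex of
  \<open>\<nu>(P)\<close>, one of them therefore leads out of the hull of \<open>\<nu>(P)\<close>; it meets no further Voronoi
  vertex, so it is a ray. Rays correspond to pairs of consecutive points on the boundary of the hull
  of \<open>P\<close>, hence to boundary points.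

  The third covers collinear iterates, to which the first does not apply: if \<open>\<nu>(P)\<close> is
  collinear then \<open>2|\<nu>(P)| \<le> |Bd(P)|\<close> (\<open>card_collinear_voronoi_iteration_le\<close>), because every
  vertex then emits a ray to either side of the common line.

  Together they give \<open>|\<nu>(Q)| \<ge> 2|Q| - |Bd(P)| - 2\<close> for every iterate \<open>Q\<close> of \<open>P\<close>, collinear or
  not; if \<open>P\<close> itself is collinear it has at most two points, and the bound is trivial. So the
  excess over \<open>|Bd(P)| + 2\<close> at least doubles in each step (if it is negative, this
  remains true as an inequality), which is the claim.\<close>

section \<open>Coordinates in the plane\<close>

definition cross :: "real^2 \<Rightarrow> real^2 \<Rightarrow> real" where
  "cross v w = v$1 * w$2 - v$2 * w$1"

text \<open>The counterclockwise rotation by a right angle.\<close>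

definition perp :: "real^2 \<Rightarrow> real^2" where
  "perp v = vector [- v$2, v$1]"

lemma inner_plane: "(x::real^2) \<bullet> y = x$1 * y$1 + x$2 * y$2"
  by (simp add: inner_vec_def sum_2)

lemma eq_plane: "(x::real^2) = y \<longleftrightarrow> x$1 = y$1 \<and> x$2 = y$2"
  by (simp add: vec_eq_iff forall_2)

lemma perp_components [simp]: "perp v $ 1 = - v$2" "perp v $ 2 = v$1"
  by (simp_all add: perp_def)

lemmas plane_simps = eq_plane inner_plane cross_def

lemma inner_perp: "perp v \<bullet> w = cross v w"
  by (simp add: plane_simps)

lemma cross_perp: "cross (perp v) w = - (v \<bullet> w)"
  by (simp add: plane_simps)

lemma cross_self [simp]: "cross v v = 0"
  by (simp add: cross_def)

lemma cross_swap: "cross w v = - cross v w"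
  by (simp add: cross_def)

lemma perp_eq_0_iff [simp]: "perp v = 0 \<longleftrightarrow> v = 0"
  by (auto simp: plane_simps)

text \<open>Cramer's rule, with the denominator multiplied out so that no case distinction on it is needed.\<close>

lemma cramer: "cross v w *\<^sub>R x = cross x w *\<^sub>R v + cross v x *\<^sub>R w"
  by (simp add: plane_simps algebra_simps)

lemma cross_eq_0_imp_scaleR:
  assumes "cross v w = 0" "v \<noteq> 0"
  obtains k where "w = k *\<^sub>R v"
proof -
  have "(v \<bullet> v) *\<^sub>R w = (v \<bullet> w) *\<^sub>R v"
    using assms(1) unfolding plane_simps by (simp add: algebra_simps)
  hence "w = ((v \<bullet> w) / (v \<bullet> v)) *\<^sub>R v"
    using assms(2) by (simp add: eq_vector_fraction_iff)
  thus ?thesis by (rule that)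
qed

lemma collinear_if_cross_0:
  fixes P :: "(real^2) set"
  assumes "r \<noteq> p" "\<And>s. s \<in> P \<Longrightarrow> cross (r - p) (s - p) = 0"
  shows "collinear P"
  unfolding collinear_alt
proof (rule exI, rule exI, rule ballI)
  fix s assume "s \<in> P"
  then obtain k where "s - p = k *\<^sub>R (r - p)"
    using cross_eq_0_imp_scaleR[OF assms(2)] assms(1) by (metis right_minus_eq)
  hence "s = p + k *\<^sub>R (r - p)" by (simp add: algebra_simps)
  thus "\<exists>c. s = p + c *\<^sub>R (r - p)" ..
qed

lemma collinear_imp_constant_inner:
  assumes "collinear (P :: (real^2) set)"
  obtains d where "d \<noteq> 0" "\<forall>x\<in>P. \<forall>y\<in>P. d \<bullet> (x - y) = 0"
proof -
  obtain u where u: "\<And>x y. x \<in> P \<Longrightarrow> y \<in> P \<Longrightarrow> \<exists>c. x - y = c *\<^sub>R u"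
    using assms unfolding collinear_def by metis
  obtain d where d: "d \<noteq> 0" "d \<bullet> u = 0"
  proof (cases "u = 0")
    case True thus ?thesis using that[of "axis 1 1"] by (simp add: axis_eq_0_iff)
  next
    case False thus ?thesis using that[of "perp u"] by (simp add: inner_perp)
  qed
  have "d \<bullet> (x - y) = 0" if xy: "x \<in> P" "y \<in> P" for x y
  proof -
    obtain c where "x - y = c *\<^sub>R u" using u[OF xy] ..
    thus ?thesis using d by simp
  qed
  hence "\<forall>x\<in>P. \<forall>y\<in>P. d \<bullet> (x - y) = 0" by simp
  with d(1) show ?thesis by (rule that)
qed

text \<open>Seen from \<open>p\<close>, both the bisector of \<open>p\<close> and \<open>q\<close> and the half-plane on the side of \<open>p\<close>
  are linear conditions on the centre \<open>x\<close>; the Voronoi polygon of \<open>p\<close> thereby becomes the feasible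
  region of a linear program.\<close>

lemma equidistant_iff_inner:
  fixes x p q :: "real^2"
  shows "dist x p = dist x q \<longleftrightarrow> 2 * ((x - p) \<bullet> (q - p)) = (q - p) \<bullet> (q - p)"
proof -
  have "dist x p = dist x q \<longleftrightarrow> (x - p) \<bullet> (x - p) = (x - q) \<bullet> (x - q)"
    by (simp add: dist_norm norm_eq)
  thus ?thesis by (simp add: algebra_simps inner_commute)
qed

lemma dist_le_iff_inner:
  fixes x p q :: "real^2"
  shows "dist x p \<le> dist x q \<longleftrightarrow> 2 * ((x - p) \<bullet> (q - p)) \<le> (q - p) \<bullet> (q - p)"
proof -
  have "dist x p \<le> dist x q \<longleftrightarrow> (x - p) \<bullet> (x - p) \<le> (x - q) \<bullet> (x - q)"
    by (simp add: dist_norm norm_le)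
  thus ?thesis by (simp add: algebra_simps inner_commute)
qed

lemma cocircular_not_collinear:
  fixes x :: "real^2"
  assumes "dist x p = dist x q" "dist x p = dist x r" "p \<noteq> q" "p \<noteq> r" "q \<noteq> r"
  shows "cross (q - p) (r - p) \<noteq> 0"
proof
  assume "cross (q - p) (r - p) = 0"
  then obtain k where k: "r - p = k *\<^sub>R (q - p)"
    using cross_eq_0_imp_scaleR assms(3) by (metis right_minus_eq)
  have "k \<noteq> 0" "k \<noteq> 1" using k assms by auto
  have 1: "2 * ((x - p) \<bullet> (q - p)) = (q - p) \<bullet> (q - p)"
    using assms equidistant_iff_inner by blast
  have "2 * ((x - p) \<bullet> (r - p)) = (r - p) \<bullet> (r - p)"
    using assms equidistant_iff_inner by blast
  hence "k * ((q - p) \<bullet> (q - p)) = k * (k * ((q - p) \<bullet> (q - p)))"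
    unfolding k using 1 by simp
  thus False using \<open>k \<noteq> 0\<close> \<open>k \<noteq> 1\<close> assms(3) by simp
qed

lemma circumcentre_unique:
  fixes x y :: "real^2"
  assumes "dist x p = dist x q" "dist x p = dist x r"
    and "dist y p = dist y q" "dist y p = dist y r"
    and "p \<noteq> q" "p \<noteq> r" "q \<noteq> r"
  shows "x = y"
proof -
  have *: "2 * ((z - p) \<bullet> (t - p)) = (t - p) \<bullet> (t - p)" if "dist z p = dist z t" for z t :: "real^2"
    using that equidistant_iff_inner by blast
  have "(x - y) \<bullet> (q - p) = 0" "(x - y) \<bullet> (r - p) = 0"
    using *[OF assms(1)] *[OF assms(2)] *[OF assms(3)] *[OF assms(4)]
    by (simp_all add: inner_diff_left)
  hence "cross (q - p) (r - p) * (x - y)$1 = 0" "cross (q - p) (r - p) * (x - y)$2 = 0"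
    unfolding plane_simps by (simp_all, algebra+)
  thus ?thesis using cocircular_not_collinear[OF assms(1,2,5,6,7)] by (simp add: eq_plane)
qed

section \<open>Voronoi vertices as centres of empty circles\<close>

text \<open>The points of \<open>P\<close> on the largest circle around \<open>x\<close> that is empty of \<open>P\<close>. Working with this
  set avoids carrying the radius of the circle along.\<close>

definition nearest :: "(real^2) set \<Rightarrow> real^2 \<Rightarrow> (real^2) set" where
  "nearest P x = {p \<in> P. \<forall>q\<in>P. dist x p \<le> dist x q}"

lemma nearest_subset: "nearest P x \<subseteq> P"
  by (auto simp: nearest_def)

lemma nearest_equidistant: "p \<in> nearest P x \<Longrightarrow> q \<in> nearest P x \<Longrightarrow> dist x p = dist x q"
  by (rule order_antisym) (simp_all add: nearest_def)

lemma obtain_three: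
  assumes "3 \<le> card A"
  obtains a b c where "{a, b, c} \<subseteq> A" "a \<noteq> b" "a \<noteq> c" "b \<noteq> c"
proof -
  obtain T where T: "T \<subseteq> A" "card T = 3"
    using obtain_subset_with_card_n[OF assms] .
  then obtain a b c where "T = {a, b, c}" "a \<noteq> b" "a \<noteq> c" "b \<noteq> c"
    unfolding card_3_iff by metis
  thus ?thesis using that[of a b c] T(1) by simp
qed

lemma nearest_circumcentre_unique:
  assumes "3 \<le> card (nearest P x)" "nearest P x \<subseteq> nearest P y"
  shows "x = y"
proof -
  obtain p q r where "{p, q, r} \<subseteq> nearest P x" "p \<noteq> q" "p \<noteq> r" "q \<noteq> r"
    using assms(1) by (rule obtain_three)
  thus ?thesis
    using assms(2) nearest_equidistant[of _ P x] nearest_equidistant[of _ P y]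
    by (intro circumcentre_unique[of x p q r y]) (simp_all add: subset_iff)
qed

text \<open>Voronoi polygons of different points are different, so three polygons through \<open>x\<close> are the same
  as three nearest points of \<open>x\<close>. Their intersection is automatically a single point, by the
  uniqueness of the circumcentre.\<close>

lemma voronoi_iteration_eq:
  assumes "finite P"
  shows "voronoi_iteration P = {x. 3 \<le> card (nearest P x)}"
proof -
  have V: "x \<in> voronoi_polygon P p \<longleftrightarrow> p \<in> nearest P x" if "p \<in> P" for x p
    using that by (auto simp: voronoi_polygon_def nearest_def dist_norm norm_minus_commute)
  have inj: "inj_on (voronoi_polygon P) P"
  proof (rule inj_onI)
    fix p q assume "p \<in> P" "q \<in> P" and eq: "voronoi_polygon P p = voronoi_polygon P q"
    have "p \<in> voronoi_polygon P p" by (simp add: voronoi_polygon_def)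
    hence "p \<in> voronoi_polygon P q" using eq by simp
    thus "p = q" using \<open>p \<in> P\<close> by (auto simp: voronoi_polygon_def)
  qed
  have "voronoi_vertex P x \<longleftrightarrow> 3 \<le> card (nearest P x)" for x
  proof
    assume "voronoi_vertex P x"
    then obtain S where S: "S \<subseteq> voronoi_polygon P ` P" "3 \<le> card S" "\<Inter> S = {x}"
      by (auto simp: voronoi_vertex_def voronoi_tessellation_def)
    obtain T where T: "T \<subseteq> P" "S = voronoi_polygon P ` T" using S(1) by (meson subset_imageE)
    have "T \<subseteq> nearest P x" using S(3) T V by blast
    moreover have "finite (nearest P x)" using assms nearest_subset[of P x] finite_subset by blast
    ultimately show "3 \<le> card (nearest P x)"
      using S(2) T 
      using card_image_le[of T "voronoi_polygon P"]
        card_mono[of "nearest P x" T] finite_subset[of T "nearest P x"] by simp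
  next
    assume c: "3 \<le> card (nearest P x)"
    let ?S = "voronoi_polygon P ` nearest P x"
    have "card ?S = card (nearest P x)"
      using inj nearest_subset[of P x] by (metis card_image inj_on_subset)
    moreover have "\<Inter> ?S = {x}"
    proof (intro equalityI subsetI)
      fix y assume "y \<in> \<Inter> ?S"
      hence "nearest P x \<subseteq> nearest P y" using V nearest_subset[of P] by blast
      thus "y \<in> {x}" using nearest_circumcentre_unique[OF c] by blast
    qed (use V nearest_subset[of P] in blast)
    ultimately show "voronoi_vertex P x"
      unfolding voronoi_vertex_def voronoi_tessellation_def
      using c by (intro exI[of _ ?S]) (auto dest: subsetD[OF nearest_subset])
  qed
  thus ?thesis by (simp add: voronoi_iteration_def)
qed

text \<open>A Voronoi vertex is determined by its set of nearest points.\<close>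

lemma finite_voronoi_iteration:
  assumes "finite P"
  shows "finite (voronoi_iteration P)"
proof (rule inj_on_finite)
  show "inj_on (nearest P) (voronoi_iteration P)"
    unfolding voronoi_iteration_eq[OF assms]
    by (rule inj_onI, rule nearest_circumcentre_unique[of P]) auto
  show "nearest P ` voronoi_iteration P \<subseteq> Pow P" by (auto dest: subsetD[OF nearest_subset])
qed (use assms in simp)

lemma nearest_eq_empty_circle:
  assumes "p \<in> nearest P x"
  shows "sphere x (dist x p) \<inter> P = nearest P x" "ball x (dist x p) \<inter> P = {}"
proof -
  have p: "p \<in> P" "\<And>q. q \<in> P \<Longrightarrow> dist x p \<le> dist x q"
    using assms by (auto simp: nearest_def)
  have "q \<in> nearest P x" if "q \<in> P" "dist x q = dist x p" for q
    using p that by (simp add: nearest_def)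
  thus "sphere x (dist x p) \<inter> P = nearest P x"
    using nearest_equidistant[OF _ assms] nearest_subset[of P x] by auto
  show "ball x (dist x p) \<inter> P = {}" using p(2) by (auto simp: not_less[symmetric])
qed

lemma empty_circle_imp_nearest:
  assumes "0 < r" "ball c r \<inter> Q = {}" "p \<in> sphere c r \<inter> Q"
  shows "r = dist c p" "p \<in> nearest Q c"
proof -
  show "r = dist c p" using assms(3) by simp
  moreover have "r \<le> dist c q" if "q \<in> Q" for q
    using assms(2) that by (auto simp: disjoint_iff not_less)
  ultimately show "p \<in> nearest Q c" using assms(3) by (simp add: nearest_def)
qed

text \<open>Needed since a sum over an infinite index set is \<open>0\<close> by convention: only for finitely many empty
  circles does a vanishing \<^const>\<open>cocircularity\<close> say anything about each of them.\<close>

lemma finite_empty_circles: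
  assumes "finite Q"
  shows "finite (empty_circles Q)"
proof (rule finite_surj)
  show "finite (voronoi_iteration Q \<times> Q)" using assms finite_voronoi_iteration by simp
  show "empty_circles Q \<subseteq> (\<lambda>(x, p). sphere x (dist x p)) ` (voronoi_iteration Q \<times> Q)"
  proof
    fix C assume "C \<in> empty_circles Q"
    then obtain c r where C: "0 < r" "C = sphere c r" "ball c r \<inter> Q = {}" "3 \<le> card (C \<inter> Q)"
      by (auto simp: empty_circles_def)
    then obtain p where p: "p \<in> sphere c r \<inter> Q"
      by (metis card.empty ex_in_conv not_numeral_le_zero)
    note n = empty_circle_imp_nearest[OF C(1,3) p]
    have "nearest Q c = C \<inter> Q" using nearest_eq_empty_circle[OF n(2)] n(1) C(2) by simp
    hence "c \<in> voronoi_iteration Q" using C(4) voronoi_iteration_eq[OF assms] by simp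
    thus "C \<in> (\<lambda>(x, p). sphere x (dist x p)) ` (voronoi_iteration Q \<times> Q)"
      using n(1) C(2) p by auto
  qed
qed

lemma card_nearest_if_no_cocircularity:
  assumes "finite P" "cocircularity P = 0" "3 \<le> card (nearest P x)"
  shows "card (nearest P x) = 3"
proof -
  obtain p q where pq: "p \<in> nearest P x" "q \<in> nearest P x" "p \<noteq> q"
    using assms(3) by (elim obtain_three) auto
  let ?C = "sphere x (dist x p)"
  have C: "?C \<inter> P = nearest P x" "ball x (dist x p) \<inter> P = {}"
    using nearest_eq_empty_circle[OF pq(1)] by auto
  have "0 < dist x p"
    using pq(3) nearest_equidistant[OF pq(1,2)] by (cases "x = p") auto
  hence "?C \<in> empty_circles P" unfolding empty_circles_def
    using C assms(3) by (intro CollectI exI[of _ x] exI[of _ "dist x p"]) simp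
  hence "card (?C \<inter> P) - 3 = 0"
    using assms(1,2) finite_empty_circles by (auto simp: cocircularity_def)
  thus ?thesis using C assms(3) by simp
qed

section \<open>Boundary points and supporting lines\<close>

lemma Bd_if_supported:
  assumes "p \<in> P" "d \<noteq> 0" "\<And>s. s \<in> P \<Longrightarrow> d \<bullet> (s - p) \<le> 0"
  shows "p \<in> Bd P"
proof -
  have "P \<subseteq> {x. d \<bullet> x \<le> d \<bullet> p}" using assms(3) by (auto simp: inner_diff_right)
  hence "convex hull P \<subseteq> {x. d \<bullet> x \<le> d \<bullet> p}"
    by (simp add: hull_minimal convex_halfspace_le)
  hence "interior (convex hull P) \<subseteq> {x. d \<bullet> x < d \<bullet> p}"
    using interior_mono interior_halfspace_le[OF assms(2)] by metis
  hence "p \<notin> interior (convex hull P)" by auto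
  moreover have "p \<in> convex hull P" using assms(1) hull_inc by metis
  ultimately show ?thesis
    using assms(1) closure_subset by (auto simp: Bd_def frontier_def)
qed

text \<open>Also when the hull is degenerate, where the line containing the hull supports it.\<close>

lemma Bd_imp_supported:
  assumes "p \<in> Bd P"
  obtains d where "d \<noteq> 0" "\<forall>s\<in>P. d \<bullet> s \<le> d \<bullet> p"
proof (cases "interior (convex hull P) = {}")
  case True
  then obtain a b where a: "a \<noteq> 0" "convex hull P \<subseteq> {x. a \<bullet> x = b}"
    using empty_interior_subset_hyperplane[of "convex hull P"] convex_convex_hull by blast
  have "P \<subseteq> {x. a \<bullet> x = b}" using a(2) hull_subset[of P convex] by simp
  moreover have "p \<in> P" using assms by (simp add: Bd_def)
  ultimately have "a \<bullet> s \<le> a \<bullet> p" if "s \<in> P" for s using that by (simp add: subset_iff)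
  hence "\<forall>s\<in>P. a \<bullet> s \<le> a \<bullet> p" by simp
  with a(1) show ?thesis by (rule that)
next
  case False
  have "p \<notin> interior (convex hull P)" using assms by (auto simp: Bd_def frontier_def)
  hence "\<exists>a b. a \<noteq> 0 \<and> (\<forall>x\<in>interior (convex hull P). a \<bullet> x \<le> b) \<and> (\<forall>x\<in>{p}. a \<bullet> x \<ge> b)"
    using False by (intro separating_hyperplane_sets) (auto simp: convex_interior)
  then obtain a b where a: "a \<noteq> 0" "\<forall>x\<in>interior (convex hull P). a \<bullet> x \<le> b" "b \<le> a \<bullet> p"
    by auto
  have "closure (interior (convex hull P)) \<subseteq> {x. a \<bullet> x \<le> a \<bullet> p}"
    using a(2,3) by (intro closure_minimal closed_halfspace_le) force
  hence "convex hull P \<subseteq> {x. a \<bullet> x \<le> a \<bullet> p}"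
    using convex_closure_interior[OF convex_convex_hull False] closure_subset[of "convex hull P"]
    by simp
  hence "a \<bullet> s \<le> a \<bullet> p" if "s \<in> P" for s
    using that hull_subset[of P convex] by (simp add: subset_iff)
  hence "\<forall>s\<in>P. a \<bullet> s \<le> a \<bullet> p" by simp
  with a(1) show ?thesis by (rule that)
qed

lemma collinear_imp_Bd_eq:
  assumes "collinear P"
  shows "Bd P = P"
proof -
  obtain d where "d \<noteq> 0" "\<forall>x\<in>P. \<forall>y\<in>P. d \<bullet> (x - y) = 0"
    using collinear_imp_constant_inner[OF assms] .
  hence "p \<in> Bd P" if "p \<in> P" for p
    using that by (intro Bd_if_supported[of p P d]) simp_all
  moreover have "Bd P \<subseteq> P" by (simp add: Bd_def)
  ultimately show ?thesis by auto
qed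

section \<open>Unbounded Voronoi edges and the boundary of the hull\<close>

lemma nearest_if_equidistant:
  "p \<in> nearest P x \<Longrightarrow> q \<in> P \<Longrightarrow> dist x p = dist x q \<Longrightarrow> q \<in> nearest P x"
  by (simp add: nearest_def)

lemma nearest_inner:
  assumes "p \<in> nearest P x"
  shows "s \<in> P \<Longrightarrow> 2 * ((x - p) \<bullet> (s - p)) \<le> (s - p) \<bullet> (s - p)"
    and "s \<in> nearest P x \<Longrightarrow> 2 * ((x - p) \<bullet> (s - p)) = (s - p) \<bullet> (s - p)"
  using assms nearest_equidistant[OF assms, of s] dist_le_iff_inner[of x p s]
    equidistant_iff_inner[of x p s]
  by (simp_all add: nearest_def)

text \<open>The bisector of \<open>p\<close> and \<open>q\<close> contains an unbounded Voronoi edge that starts at \<open>x\<close>. The pair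
  is oriented so that \<open>P\<close> lies on the left of the line from \<open>p\<close> to \<open>q\<close>; the ray then leaves to
  the right. The last conjunct excludes circles that are empty but touch \<open>P\<close> only at \<open>p\<close> and \<open>q\<close>
  on this line, whose centres lie further out on the ray.\<close>

definition hull_ray :: "(real^2) set \<Rightarrow> real^2 \<Rightarrow> real^2 \<Rightarrow> real^2 \<Rightarrow> bool" where
  "hull_ray P p q x \<longleftrightarrow> p \<in> nearest P x \<and> q \<in> nearest P x \<and> p \<noteq> q \<and>
    (\<forall>s\<in>P. 0 \<le> cross (q - p) (s - p)) \<and> (\<exists>s\<in>nearest P x. 0 < cross (q - p) (s - p))"

lemma hull_ray_origin_in_Bd:
  assumes "hull_ray P p q x"
  shows "p \<in> Bd P"
proof (rule Bd_if_supported)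
  show "p \<in> P" using assms nearest_subset[of P x] by (auto simp: hull_ray_def)
  show "- perp (q - p) \<noteq> 0" using assms by (auto simp: hull_ray_def)
  show "- perp (q - p) \<bullet> (s - p) \<le> 0" if "s \<in> P" for s
    using assms that by (simp add: hull_ray_def inner_perp)
qed

text \<open>A point of \<open>P\<close> is the origin of at most one counterclockwise hull edge. Two such edges at \<open>p\<close>
  point in the same direction, and neither is strictly shorter, since its end would then lie
  inside the empty circle through the ends of the longer one. On the left of
  the edge, the discs of two circles through the same \<open>p\<close> and \<open>q\<close> are nested, so both circles can
  be empty and carry a point there only if they agree.\<close>

lemma hull_ray_unique:
  assumes "hull_ray P p q x" "hull_ray P p q' x'"
  shows "q = q'" "x = x'"
proof -
  define v v' where "v = q - p" and "v' = q' - p"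
  have x: "p \<in> nearest P x" "q \<in> nearest P x" "v \<noteq> 0" "\<And>s. s \<in> P \<Longrightarrow> 0 \<le> cross v (s - p)"
    using assms(1) by (auto simp: hull_ray_def v_def)
  have x': "p \<in> nearest P x'" "q' \<in> nearest P x'" "v' \<noteq> 0" "\<And>s. s \<in> P \<Longrightarrow> 0 \<le> cross v' (s - p)"
    using assms(2) by (auto simp: hull_ray_def v'_def)
  obtain s where s: "s \<in> nearest P x" "0 < cross v (s - p)"
    using assms(1) by (auto simp: hull_ray_def v_def)
  obtain s' where s': "s' \<in> nearest P x'" "0 < cross v' (s' - p)"
    using assms(2) by (auto simp: hull_ray_def v'_def)
  have P: "q \<in> P" "q' \<in> P" "s \<in> P" "s' \<in> P"
    using x x' s s' by (simp_all add: nearest_def)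
  have "cross v v' = 0"
    using x(4)[OF P(2)] x'(4)[OF P(1)] cross_swap[of v v'] by (simp add: v_def v'_def)
  then obtain k where k: "v' = k *\<^sub>R v"
    using cross_eq_0_imp_scaleR x(3) by metis
  have "k > 0"
  proof -
    have "cross v' (s - p) = k * cross v (s - p)" by (simp add: k cross_def algebra_simps)
    hence "0 \<le> k * cross v (s - p)" using x'(4)[OF P(3)] by simp
    hence "0 \<le> k" using s(2) by (simp add: zero_le_mult_iff)
    thus ?thesis using k x'(3) by (cases "k = 0") auto
  qed
  have vv: "0 < v \<bullet> v" using x(3) by simp
  have "2 * ((x - p) \<bullet> v) = v \<bullet> v" "2 * (k * ((x - p) \<bullet> v)) \<le> k * (k * (v \<bullet> v))"
    using nearest_inner(2)[OF x(1,2)] nearest_inner(1)[OF x(1) P(2)]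
    unfolding v_def[symmetric] v'_def[symmetric] k by simp_all
  hence "k * (v \<bullet> v) \<le> k * (k * (v \<bullet> v))" by (simp add: algebra_simps)
  hence "1 \<le> k" using \<open>k > 0\<close> vv by simp
  have "2 * (k * ((x' - p) \<bullet> v)) = k * (k * (v \<bullet> v))" "2 * ((x' - p) \<bullet> v) \<le> v \<bullet> v"
    using nearest_inner(2)[OF x'(1,2)] nearest_inner(1)[OF x'(1) P(1)]
    unfolding v_def[symmetric] v'_def[symmetric] k by simp_all
  hence "k * (v \<bullet> v) \<le> 1 * (v \<bullet> v)" using \<open>k > 0\<close> by simp
  hence "k \<le> 1" using vv by simp
  with \<open>1 \<le> k\<close> have "v' = v" using k by simp
  thus q: "q = q'" by (simp add: v_def v'_def)
  define D where "D = cross v (x' - x)"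
  have "(x' - x) \<bullet> v = 0"
    using nearest_inner(2)[OF x(1,2)] nearest_inner(2)[OF x'(1,2)] q
    by (simp add: v_def inner_diff_left)
  hence e: "(v \<bullet> v) *\<^sub>R (x' - x) = D *\<^sub>R perp v"
    unfolding D_def plane_simps perp_components vector_scaleR_component real_scaleR_def by algebra
  have D: "(v \<bullet> v) * ((x' - x) \<bullet> z) = D * cross v z" for z
    using arg_cong[OF e, of "\<lambda>y. y \<bullet> z"] by (simp add: inner_perp)
  have "(x' - x) \<bullet> (s - p) \<le> 0" "0 \<le> (x' - x) \<bullet> (s' - p)"
    using nearest_inner(2)[OF x(1) s(1)] nearest_inner(1)[OF x'(1) P(3)]
      nearest_inner(2)[OF x'(1) s'(1)] nearest_inner(1)[OF x(1) P(4)]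
    by (simp_all add: inner_diff_left)
  hence "D * cross v (s - p) \<le> 0" "0 \<le> D * cross v (s' - p)"
    unfolding D[symmetric] using vv by (simp_all add: mult_le_0_iff)
  hence "D = 0" using s(2) s'(2) \<open>v' = v\<close> by (simp add: mult_le_0_iff zero_le_mult_iff)
  thus "x = x'" using e vv by simp
qed

text \<open>If there are points of \<open>P\<close> beyond the side \<open>p q\<close> of the triangle, the Voronoi edge across this
  side ends at another vertex: move the centre along the bisector, keeping \<open>p\<close> and \<open>q\<close> on the
  circle, until the circle first hits a point beyond the side.\<close>

lemma slide_to_next_vertex:
  assumes "finite P" and n: "nearest P x = {p, q, r}" and "0 < cross (q - p) (r - p)"
    and "s \<in> P" "cross (q - p) (s - p) < 0"
  obtains t where "0 < t" "x - t *\<^sub>R perp (q - p) \<in> voronoi_iteration P"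
proof -
  define v where "v = q - p"
  define R where "R = {s \<in> P. cross v (s - p) < 0}"
  define gap where "gap s = (s - p) \<bullet> (s - p) - 2 * ((x - p) \<bullet> (s - p))" for s
  \<comment> \<open>the multiple of the normal by which the centre moves until the circle through \<open>p\<close> and
    \<open>q\<close> hits \<open>s\<close>; \<open>gap s\<close> is the power of \<open>s\<close> with respect to the initial circle\<close>
  define \<tau> where "\<tau> s = gap s / (- 2 * cross v (s - p))" for s
  have p: "p \<in> nearest P x" "p \<in> P" and q: "q \<in> nearest P x" "q \<in> P"
    using n nearest_subset[of P x] by auto
  have gap_nonneg: "0 \<le> gap s" if "s \<in> P" for s
    using nearest_inner(1)[OF p(1) that] by (simp add: gap_def)
  have \<tau>_pos: "0 < \<tau> s" if "s \<in> R" for s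
  proof -
    have "s \<notin> {p, q, r}" using that assms(3) by (auto simp: R_def v_def cross_def)
    hence "dist x p \<noteq> dist x s"
      using nearest_if_equidistant[OF p(1), of s] n that by (auto simp: R_def)
    hence "gap s \<noteq> 0" using equidistant_iff_inner[of x p s] by (simp add: gap_def)
    hence "0 < gap s" using gap_nonneg[of s] that by (auto simp: R_def)
    thus ?thesis using that by (auto simp: \<tau>_def R_def intro!: divide_pos_neg)
  qed
  have "finite R" "R \<noteq> {}" using assms by (auto simp: R_def v_def)
  then obtain u where u: "u \<in> R" "\<And>s. s \<in> R \<Longrightarrow> \<tau> u \<le> \<tau> s"
    using ex_is_arg_min_if_finite[of R \<tau>] unfolding is_arg_min_linorder by metis
  define t where "t = \<tau> u"
  define y where "y = x - t *\<^sub>R perp v"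
  have "0 < t" using \<tau>_pos[OF u(1)] by (simp add: t_def)
  have y: "2 * ((y - p) \<bullet> (s - p)) = 2 * ((x - p) \<bullet> (s - p)) - 2 * t * cross v (s - p)" for s
    by (simp add: y_def inner_diff_left inner_perp[symmetric])
  have "dist y p \<le> dist y s" if "s \<in> P" for s
  proof (cases "s \<in> R")
    case True
    hence "t \<le> gap s / (- 2 * cross v (s - p))" using u(2) by (simp add: t_def \<tau>_def)
    hence "t * (- 2 * cross v (s - p)) \<le> gap s"
      using True by (subst (asm) pos_le_divide_eq) (auto simp: R_def)
    thus ?thesis unfolding dist_le_iff_inner y by (simp add: gap_def algebra_simps)
  next
    case False
    hence "0 \<le> t * cross v (s - p)" using that \<open>0 < t\<close> by (simp add: R_def not_less)
    thus ?thesis unfolding dist_le_iff_inner y using gap_nonneg[OF that] by (simp add: gap_def)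
  qed
  hence py: "p \<in> nearest P y" using p(2) by (simp add: nearest_def)
  have "q \<in> nearest P y"
    using nearest_inner(2)[OF p(1) q(1)]
    by (intro nearest_if_equidistant[OF py q(2)], unfold equidistant_iff_inner y)
       (simp add: v_def)
  moreover have "t * (- 2 * cross v (u - p)) = gap u"
    using u(1) by (simp add: t_def \<tau>_def R_def)
  hence "u \<in> nearest P y"
    using u(1) by (intro nearest_if_equidistant[OF py], unfold equidistant_iff_inner y)
       (simp_all add: R_def gap_def)
  ultimately have sub: "{p, q, u} \<subseteq> nearest P y" using py by simp
  have "p \<noteq> q" "u \<notin> {p, q}" using assms(3) u(1) by (auto simp: R_def v_def cross_def)
  hence "card {p, q, u} = 3" by auto
  hence "3 \<le> card (nearest P y)"
    using card_mono[OF finite_subset[OF nearest_subset assms(1)] sub] by simp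
  hence "y \<in> voronoi_iteration P" using voronoi_iteration_eq[OF assms(1)] by simp
  thus ?thesis using that[of t] \<open>0 < t\<close> unfolding y_def v_def by simp
qed

text \<open>Otherwise the vertex at the other end of the edge across \<open>p q\<close> would be further out in
  direction \<open>w\<close>.\<close>

lemma hull_ray_if_outermost:
  assumes "finite P" and n: "nearest P x = {p, q, r}" and "0 < cross (q - p) (r - p)"
    and "0 < cross w (q - p)" "\<forall>y\<in>voronoi_iteration P. w \<bullet> y \<le> w \<bullet> x"
  shows "hull_ray P p q x"
proof -
  have "0 \<le> cross (q - p) (s - p)" if s: "s \<in> P" for s
  proof (rule ccontr)
    assume "\<not> 0 \<le> cross (q - p) (s - p)"
    then obtain t where t: "0 < t" "x - t *\<^sub>R perp (q - p) \<in> voronoi_iteration P"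
      using slide_to_next_vertex[OF assms(1-3) s] by (auto simp: not_le)
    have "w \<bullet> (x - t *\<^sub>R perp (q - p)) = w \<bullet> x + t * cross w (q - p)"
      by (simp add: plane_simps algebra_simps)
    thus False using bspec[OF assms(5) t(2)] t(1) assms(4) by (simp add: mult_le_0_iff)
  qed
  moreover have "p \<noteq> q" using assms(3) by (auto simp: cross_def)
  ultimately show ?thesis using n assms(3) by (auto simp: hull_ray_def)
qed

lemma nearest_triangle:
  assumes "finite P" "cocircularity P = 0" "x \<in> voronoi_iteration P"
  obtains p q r where "nearest P x = {p, q, r}" "0 < cross (q - p) (r - p)"
proof -
  have "card (nearest P x) = 3"
    using card_nearest_if_no_cocircularity assms voronoi_iteration_eq by simp
  then obtain p q r where n: "nearest P x = {p, q, r}" "p \<noteq> q" "p \<noteq> r" "q \<noteq> r"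
    unfolding card_3_iff by metis
  have "cross (q - p) (r - p) \<noteq> 0"
    using n nearest_equidistant[of p P x] by (intro cocircular_not_collinear[of x]) simp_all
  thus ?thesis
    using that[of p q r] that[of p r q] n(1) cross_swap[of "q - p" "r - p"]
    by (cases "0 < cross (q - p) (r - p)") (auto simp: insert_commute)
qed

text \<open>The outer normals of the three sides sum to \<open>0\<close> and span the plane, so one of them has a positive
  component in direction \<open>w\<close>.\<close>

lemma extreme_vertex_has_hull_ray:
  assumes "finite P" "cocircularity P = 0" "x \<in> voronoi_iteration P" "w \<noteq> 0"
    and max: "\<forall>y\<in>voronoi_iteration P. w \<bullet> y \<le> w \<bullet> x"
  shows "\<exists>p q. hull_ray P p q x \<and> 0 < cross w (q - p)"
proof -
  obtain p q r where n: "nearest P x = {p, q, r}" and ccw: "0 < cross (q - p) (r - p)"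
    using assms by (elim nearest_triangle)
  have rot: "cross (r - q) (p - q) = cross (q - p) (r - p)"
    "cross (p - r) (q - r) = cross (q - p) (r - p)"
    by (simp_all add: cross_def algebra_simps)
  have sum: "cross w (q - p) + cross w (r - q) + cross w (p - r) = 0"
    by (simp add: cross_def algebra_simps)
  have "0 < cross w (q - p) \<or> 0 < cross w (r - q) \<or> 0 < cross w (p - r)"
  proof (rule ccontr)
    assume "\<not> ?thesis"
    hence "cross w (q - p) = 0" "cross w (p - r) = 0" using sum by linarith+
    hence "cross (q - p) w = 0" "cross w (r - p) = 0" by (simp_all add: cross_def algebra_simps)
    hence "w = 0" using cramer[of "q - p" "r - p" w] ccw by simp
    thus False using \<open>w \<noteq> 0\<close> by simp
  qed
  moreover have "nearest P x = {q, r, p}" "nearest P x = {r, p, q}" using n by auto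
  ultimately show ?thesis
    using hull_ray_if_outermost[OF assms(1) _ _ _ max] n ccw rot by metis
qed

lemma finite_Bd: "finite P \<Longrightarrow> finite (Bd P)"
  by (simp add: Bd_def)

lemma card_Bd_voronoi_iteration_le:
  assumes "finite P" "cocircularity P = 0"
  shows "card (Bd (voronoi_iteration P)) \<le> card (Bd P)"
proof -
  have "\<exists>p q. hull_ray P p q x" if x: "x \<in> Bd (voronoi_iteration P)" for x
  proof -
    obtain w where "w \<noteq> 0" "\<forall>y\<in>voronoi_iteration P. w \<bullet> y \<le> w \<bullet> x"
      using Bd_imp_supported[OF x] .
    thus ?thesis using extreme_vertex_has_hull_ray[OF assms, of x w] x by (auto simp: Bd_def)
  qed
  then obtain f where f: "\<And>x. x \<in> Bd (voronoi_iteration P) \<Longrightarrow> \<exists>q. hull_ray P (f x) q x"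
    by metis
  show ?thesis
  proof (rule card_inj_on_le)
    show "inj_on f (Bd (voronoi_iteration P))"
      using f hull_ray_unique(2) by (metis inj_onI)
    show "f ` Bd (voronoi_iteration P) \<subseteq> Bd P" using f hull_ray_origin_in_Bd by blast
  qed (use assms finite_Bd in simp)
qed

lemma card_collinear_voronoi_iteration_le:
  assumes "finite P" "cocircularity P = 0" "collinear (voronoi_iteration P)"
  shows "2 * card (voronoi_iteration P) \<le> card (Bd P)"
proof -
  let ?V = "voronoi_iteration P"
  obtain w where w: "w \<noteq> 0" "\<forall>x\<in>?V. \<forall>y\<in>?V. w \<bullet> (x - y) = 0"
    using collinear_imp_constant_inner[OF assms(3)] .
  define dir where "dir b = (if b then w else - w)" for b
  have "\<exists>p q. hull_ray P p q x \<and> 0 < cross (dir b) (q - p)" if "x \<in> ?V" for x b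
  proof (rule extreme_vertex_has_hull_ray[OF assms(1,2) that])
    show "dir b \<noteq> 0" using w(1) by (simp add: dir_def)
    show "\<forall>y\<in>?V. dir b \<bullet> y \<le> dir b \<bullet> x"
    proof
      fix y assume "y \<in> ?V"
      hence "w \<bullet> (x - y) = 0" using w(2) \<open>x \<in> ?V\<close> by simp
      thus "dir b \<bullet> y \<le> dir b \<bullet> x" by (simp add: dir_def inner_diff_right)
    qed
  qed
  then obtain f g where f: "\<And>x b. x \<in> ?V \<Longrightarrow> hull_ray P (f x b) (g x b) x"
    "\<And>x b. x \<in> ?V \<Longrightarrow> 0 < cross (dir b) (g x b - f x b)"
    by metis
  \<comment> \<open>two rays per vertex, told apart by the side of the line to which they leave\<close>
  have "card (?V \<times> (UNIV :: bool set)) \<le> card (Bd P)"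
  proof (rule card_inj_on_le)
    show "inj_on (\<lambda>(x, b). f x b) (?V \<times> UNIV)"
    proof (rule inj_onI, clarify)
      fix x b y c assume V: "x \<in> ?V" "y \<in> ?V" and e: "f x b = f y c"
      have *: "x = y" "g x b = g y c"
        using hull_ray_unique[OF f(1)[OF V(1), of b]] f(1)[OF V(2), of c] e by auto
      have "b = c"
      proof (rule ccontr)
        assume "b \<noteq> c"
        hence "dir c = - dir b" by (auto simp: dir_def)
        thus False using f(2)[OF V(1), of b] f(2)[OF V(2), of c] e *
          by (simp add: cross_def)
      qed
      with * show "x = y \<and> b = c" by simp
    qed
    show "(\<lambda>(x, b). f x b) ` (?V \<times> UNIV) \<subseteq> Bd P"
      using f(1) by (auto intro: hull_ray_origin_in_Bd)
  qed (use assms finite_Bd in simp)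
  thus ?thesis by (simp add: card_cartesian_product)
qed

section \<open>Counting Voronoi vertices by their middle generator\<close>

text \<open>For \<open>e\<close> not parallel to any difference of points of \<open>P\<close>: starting at \<open>p\<close> in direction \<open>e\<close>, one
  stays in the convex hull for a while.\<close>

definition in_cone :: "(real^2) set \<Rightarrow> real^2 \<Rightarrow> real^2 \<Rightarrow> bool" where
  "in_cone P p e \<longleftrightarrow>
    (\<exists>q\<in>P. \<exists>r\<in>P. \<exists>\<alpha>>0. \<exists>\<beta>>0. e = \<alpha> *\<^sub>R (q - p) + \<beta> *\<^sub>R (r - p))"

text \<open>Starting at the corner \<open>p\<close> in direction \<open>e\<close>, one enters the interior of the Delaunay triangle
  with circumcentre \<open>x\<close>.\<close>

definition apex :: "(real^2) set \<Rightarrow> real^2 \<Rightarrow> real^2 \<Rightarrow> real^2 \<Rightarrow> bool" where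
  "apex P p e x \<longleftrightarrow> (\<exists>q r. nearest P x = {p, q, r} \<and> p \<noteq> q \<and> p \<noteq> r \<and> q \<noteq> r \<and>
    (\<exists>\<alpha>>0. \<exists>\<beta>>0. e = \<alpha> *\<^sub>R (q - p) + \<beta> *\<^sub>R (r - p)))"

text \<open>For \<open>x\<close> in the Voronoi polygon of \<open>p\<close>, the coordinates \<open>(x - p) \<bullet> (q - p)\<close> and
  \<open>(x - p) \<bullet> (r - p)\<close> are bounded above. A combination of them with positive coefficients is bounded
  below by the condition on \<open>e\<close>, so each is bounded below as well.\<close>

lemma compact_cell_above:
  assumes "q \<in> P" "r \<in> P" "0 < \<alpha>" "0 < \<beta>" and e: "e = \<alpha> *\<^sub>R (q - p) + \<beta> *\<^sub>R (r - p)"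
    and D: "cross (q - p) (r - p) \<noteq> 0"
  shows "compact {x. (\<forall>s\<in>P. dist x p \<le> dist x s) \<and> e \<bullet> p \<le> e \<bullet> x}" (is "compact ?K")
proof -
  define v w where "v = q - p" and "w = r - p"
  define M where "M = v \<bullet> v + w \<bullet> w + \<beta> * (w \<bullet> w) / \<alpha> + \<alpha> * (v \<bullet> v) / \<beta>"
  define B where "B = (M * (\<bar>v$1\<bar> + \<bar>v$2\<bar>) + M * (\<bar>w$1\<bar> + \<bar>w$2\<bar>)) / \<bar>cross v w\<bar>"
  have "dist p x \<le> B" if "x \<in> ?K" for x
  proof -
    define z where "z = x - p"
    define a b where "a = z \<bullet> v" and "b = z \<bullet> w"
    have a: "2 * a \<le> v \<bullet> v" and b: "2 * b \<le> w \<bullet> w"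
      using that assms(1,2) unfolding dist_le_iff_inner by (auto simp: a_def b_def z_def v_def w_def)
    have "0 \<le> e \<bullet> z" using that by (simp add: z_def inner_diff_right)
    hence ab: "0 \<le> \<alpha> * a + \<beta> * b"
      by (simp add: e a_def b_def v_def w_def inner_add_left inner_commute[of z])
    have vw: "0 \<le> v \<bullet> v" "0 \<le> w \<bullet> w" by simp_all
    have "\<beta> * (2 * b) \<le> \<beta> * (w \<bullet> w)" "\<alpha> * (2 * a) \<le> \<alpha> * (v \<bullet> v)"
      using a b assms(3,4) by (simp_all del: inner_ge_zero)
    moreover have "0 \<le> \<beta> * (w \<bullet> w)" "0 \<le> \<alpha> * (v \<bullet> v)" using vw assms(3,4) by simp_all
    ultimately have "- (\<beta> * (w \<bullet> w)) \<le> \<alpha> * a" "- (\<alpha> * (v \<bullet> v)) \<le> \<beta> * b"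
      using ab by linarith+
    hence "- (\<beta> * (w \<bullet> w) / \<alpha>) \<le> a" "- (\<alpha> * (v \<bullet> v) / \<beta>) \<le> b"
      using assms(3,4) by (simp_all add: field_simps)
    moreover have "0 \<le> \<beta> * (w \<bullet> w) / \<alpha>" "0 \<le> \<alpha> * (v \<bullet> v) / \<beta>"
      using vw assms(3,4) by simp_all
    ultimately have M: "\<bar>a\<bar> \<le> M" "\<bar>b\<bar> \<le> M"
      using a b vw unfolding M_def abs_le_iff by - (intro conjI; linarith)+
    have 1: "cross v w * z$1 = a * w$2 - b * v$2" "cross v w * z$2 = b * v$1 - a * w$1"
      unfolding a_def b_def plane_simps by algebra+
    have prod: "\<bar>a * c - b * d\<bar> \<le> M * \<bar>c\<bar> + M * \<bar>d\<bar>" for c d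
      using mult_right_mono[OF M(1), of "\<bar>c\<bar>"] mult_right_mono[OF M(2), of "\<bar>d\<bar>"]
        abs_triangle_ineq4[of "a * c" "b * d"] by (simp add: abs_mult)
    have "\<bar>cross v w\<bar> * \<bar>z$1\<bar> \<le> M * \<bar>w$2\<bar> + M * \<bar>v$2\<bar>"
      using prod[of "w$2" "v$2"] unfolding abs_mult[symmetric] 1 .
    moreover have "\<bar>cross v w\<bar> * \<bar>z$2\<bar> \<le> M * \<bar>w$1\<bar> + M * \<bar>v$1\<bar>"
      using prod[of "w$1" "v$1"] unfolding abs_mult[symmetric] 1 by (simp add: abs_minus_commute)
    ultimately have "\<bar>cross v w\<bar> * (\<bar>z$1\<bar> + \<bar>z$2\<bar>)
        \<le> M * (\<bar>v$1\<bar> + \<bar>v$2\<bar>) + M * (\<bar>w$1\<bar> + \<bar>w$2\<bar>)"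
      by (simp add: algebra_simps)
    hence "\<bar>z$1\<bar> + \<bar>z$2\<bar> \<le> B"
      using D by (simp add: B_def v_def w_def field_simps)
    moreover have "norm z \<le> \<bar>z$1\<bar> + \<bar>z$2\<bar>" using norm_le_l1_cart[of z] by (simp add: sum_2)
    ultimately show ?thesis by (simp add: z_def dist_norm norm_minus_commute)
  qed
  hence "bounded ?K" unfolding bounded_def by blast
  moreover have "?K = (\<Inter>s\<in>P. {x. dist x p \<le> dist x s}) \<inter> {x. e \<bullet> p \<le> e \<bullet> x}" by auto
  hence "closed ?K"
    by (simp only:) (intro closed_Int closed_INT ballI closed_Collect_le continuous_intros)
  ultimately show ?thesis by (simp add: compact_eq_bounded_closed)
qed

text \<open>At a maximum of \<open>e\<close> over the Voronoi polygon of \<open>p\<close>, no direction of ascent is compatible with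
  the active constraints, which are those of the points in \<open>nearest P x\<close>: the others have slack and
  permit a small step.\<close>

lemma no_ascent_at_optimum:
  assumes "finite P" "p \<in> nearest P x" "0 < e \<bullet> d"
    and "\<forall>s\<in>nearest P x. d \<bullet> (s - p) \<le> 0"
    and opt: "\<And>y. p \<in> nearest P y \<Longrightarrow> e \<bullet> y \<le> e \<bullet> x"
  shows False
proof -
  have p: "p \<in> P" using assms(2) nearest_subset by blast
  have "\<forall>\<^sub>F \<delta> in at_right 0. dist (x + \<delta> *\<^sub>R d) p \<le> dist (x + \<delta> *\<^sub>R d) s" if s: "s \<in> P" for s
  proof -
    let ?g = "(s - p) \<bullet> (s - p) - 2 * ((x - p) \<bullet> (s - p))"
    have *: "dist (x + \<delta> *\<^sub>R d) p \<le> dist (x + \<delta> *\<^sub>R d) s \<longleftrightarrow> \<delta> * (2 * (d \<bullet> (s - p))) \<le> ?g" for \<delta>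
      unfolding dist_le_iff_inner by (simp add: inner_add_left inner_diff_left algebra_simps)
    show ?thesis
    proof (cases "s \<in> nearest P x")
      case True
      hence "?g = 0" "d \<bullet> (s - p) \<le> 0" using nearest_inner(2)[OF assms(2)] assms(4) by auto
      thus ?thesis unfolding * using eventually_at_right_less[of "0::real"]
        by (auto elim!: eventually_mono simp: mult_le_0_iff)
    next
      case False
      hence "dist x p \<noteq> dist x s" using nearest_if_equidistant[OF assms(2) s] by blast
      hence "0 < ?g"
        using nearest_inner(1)[OF assms(2) s] equidistant_iff_inner[of x p s] by simp
      moreover have "((\<lambda>\<delta>. \<delta> * (2 * (d \<bullet> (s - p)))) \<longlongrightarrow> 0) (at_right 0)"
        by (intro tendsto_mult_left_zero tendsto_ident_at)
      ultimately have "\<forall>\<^sub>F \<delta> in at_right 0. \<delta> * (2 * (d \<bullet> (s - p))) < ?g"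
        using order_tendstoD(2) by fast
      thus ?thesis unfolding * by (rule eventually_mono) simp
    qed
  qed
  hence "\<forall>\<^sub>F \<delta> in at_right 0. \<forall>s\<in>P. dist (x + \<delta> *\<^sub>R d) p \<le> dist (x + \<delta> *\<^sub>R d) s"
    using assms(1) by (simp add: eventually_ball_finite)
  hence "\<forall>\<^sub>F \<delta> in at_right 0. 0 < \<delta> \<and> p \<in> nearest P (x + \<delta> *\<^sub>R d)"
    using eventually_at_right_less[of "0::real"]
    by eventually_elim (use p in \<open>simp add: nearest_def\<close>)
  then obtain \<delta> where "0 < \<delta>" "p \<in> nearest P (x + \<delta> *\<^sub>R d)"
    using eventually_happens trivial_limit_at_right_real by blast
  thus False using opt[of "x + \<delta> *\<^sub>R d"] assms(3) by (simp add: inner_add_right mult_le_0_iff)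
qed

text \<open>Let \<open>x\<close> maximise \<open>e\<close> over the Voronoi polygon of \<open>p\<close>. If \<open>e\<close> were outside the open cone of
  the active constraints, one of the perpendiculars of the constraints, suitably oriented, would be
  a direction of ascent. As \<open>e\<close> is not parallel to any single constraint, there are at least two
  active ones, and no more than two because there is no cocircularity.\<close>

lemma apex_exists:
  assumes "finite P" "cocircularity P = 0" "p \<in> P" "in_cone P p e" "e \<noteq> 0"
    and gen: "\<And>s. s \<in> P \<Longrightarrow> s \<noteq> p \<Longrightarrow> cross e (s - p) \<noteq> 0"
  shows "\<exists>x. apex P p e x"
proof -
  obtain q r \<alpha> \<beta> where q: "q \<in> P" "r \<in> P" "0 < \<alpha>" "0 < \<beta>"
    and e: "e = \<alpha> *\<^sub>R (q - p) + \<beta> *\<^sub>R (r - p)"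
    using assms(4) by (auto simp: in_cone_def)
  have ce: "cross e (q - p) = - \<beta> * cross (q - p) (r - p)"
    "cross e (r - p) = \<alpha> * cross (q - p) (r - p)"
    unfolding e by (simp_all add: cross_def algebra_simps)
  have D: "cross (q - p) (r - p) \<noteq> 0"
  proof
    assume "cross (q - p) (r - p) = 0"
    hence "q = p" "r = p" using gen[OF q(1)] gen[OF q(2)] ce by auto
    thus False using e \<open>e \<noteq> 0\<close> by simp
  qed
  let ?K = "{x. (\<forall>s\<in>P. dist x p \<le> dist x s) \<and> e \<bullet> p \<le> e \<bullet> x}"
  have "p \<in> ?K" by simp
  hence "?K \<noteq> {}" by blast
  hence "\<exists>x\<in>?K. \<forall>y\<in>?K. e \<bullet> y \<le> e \<bullet> x"
    by (intro continuous_attains_sup compact_cell_above[OF q e D] continuous_intros)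
  then obtain x where x: "x \<in> ?K" "\<forall>y\<in>?K. e \<bullet> y \<le> e \<bullet> x"
    by (rule bexE)
  have px: "p \<in> nearest P x" using x(1) assms(3) by (simp add: nearest_def)
  have opt: "e \<bullet> y \<le> e \<bullet> x" if "p \<in> nearest P y" for y
  proof (cases "e \<bullet> p \<le> e \<bullet> y")
    case True thus ?thesis using x(2) that by (simp add: nearest_def)
  next
    case False thus ?thesis using x(1) by simp
  qed
  have no_ascent: "\<not> 0 < e \<bullet> d" if "\<forall>s\<in>nearest P x. d \<bullet> (s - p) \<le> 0" for d
    using no_ascent_at_optimum[OF assms(1) px _ that opt] by metis
  have not_on_line: "\<not> nearest P x \<subseteq> {p, s}" if "s \<in> P" "s \<noteq> p" for s
  proof
    assume sub: "nearest P x \<subseteq> {p, s}"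
    let ?d = "cross (s - p) e *\<^sub>R perp (s - p)"
    have "cross (s - p) e \<noteq> 0" using gen[OF that] cross_swap[of e "s - p"] by simp
    hence "0 < e \<bullet> ?d" using inner_commute[of e "perp (s - p)"]
      by (auto simp: inner_perp zero_less_mult_iff linorder_neq_iff)
    moreover have "?d \<bullet> (t - p) \<le> 0" if "t \<in> {p, s}" for t
      using that inner_perp[of "s - p" "s - p"] by auto
    hence "\<forall>t\<in>nearest P x. ?d \<bullet> (t - p) \<le> 0" using sub by (meson subsetD)
    ultimately show False by (metis no_ascent)
  qed
  have "finite (nearest P x)" using assms(1) nearest_subset finite_subset by metis
  obtain s where s: "s \<in> nearest P x" "s \<noteq> p"
  proof (cases "q = p")
    case True
    hence "r \<noteq> p" using D by auto
    thus ?thesis using not_on_line[OF q(2)] that by blast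
  next
    case False
    thus ?thesis using not_on_line[OF q(1)] that by blast
  qed
  obtain t where t: "t \<in> nearest P x" "t \<noteq> p" "t \<noteq> s"
    using not_on_line[of s] s subsetD[OF nearest_subset s(1)] by blast
  have sub: "{p, s, t} \<subseteq> nearest P x" and c3: "card {p, s, t} = 3" using px s t by auto
  hence "3 \<le> card (nearest P x)" using card_mono[OF \<open>finite (nearest P x)\<close> sub] by simp
  hence "card (nearest P x) = 3" using card_nearest_if_no_cocircularity assms(1,2) by simp
  hence n: "nearest P x = {p, s, t}"
    using card_subset_eq[OF \<open>finite (nearest P x)\<close> sub] c3 by simp
  define v w where "v = s - p" and "w = t - p"
  have vw: "cross v w \<noteq> 0" unfolding v_def w_def
    using nearest_equidistant[OF px s(1)] nearest_equidistant[OF px t(1)] s(2) t(2,3)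
    by (intro cocircular_not_collinear[of x]) metis+
  have "s \<in> P" "t \<in> P" using s(1) t(1) nearest_subset[of P x] by (simp_all add: subset_iff)
  define a b where "a = cross e w / cross v w" and "b = cross v e / cross v w"
  have e': "e = a *\<^sub>R v + b *\<^sub>R w"
  proof -
    have "cross v w *\<^sub>R e = cross v w *\<^sub>R (a *\<^sub>R v + b *\<^sub>R w)"
      using vw by (subst cramer) (simp add: a_def b_def scaleR_add_right)
    thus ?thesis using vw by simp
  qed
  have "a \<noteq> 0" "b \<noteq> 0"
    using gen[OF \<open>t \<in> P\<close>] gen[OF \<open>s \<in> P\<close>] s t vw cross_swap[of e v]
    by (auto simp: a_def b_def v_def w_def)
  moreover have "\<not> a < 0"
  proof
    assume "a < 0"
    let ?d = "cross v w *\<^sub>R perp w"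
    have "e \<bullet> ?d = - a * (cross v w)\<^sup>2" unfolding e' by (simp add: plane_simps power2_eq_square algebra_simps)
    hence "0 < e \<bullet> ?d" using \<open>a < 0\<close> vw by (simp add: mult_neg_pos)
    moreover have "?d \<bullet> v \<le> 0" "?d \<bullet> w \<le> 0"
      by (simp_all add: inner_perp cross_swap[of w v])
    hence "\<forall>u\<in>nearest P x. ?d \<bullet> (u - p) \<le> 0" unfolding n by (simp add: v_def w_def)
    ultimately show False by (metis no_ascent)
  qed
  moreover have "\<not> b < 0"
  proof
    assume "b < 0"
    let ?d = "- cross v w *\<^sub>R perp v"
    have "e \<bullet> ?d = - b * (cross v w)\<^sup>2" unfolding e' by (simp add: plane_simps power2_eq_square algebra_simps)
    hence "0 < e \<bullet> ?d" using \<open>b < 0\<close> vw by (simp add: mult_neg_pos)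
    moreover have "?d \<bullet> v \<le> 0" "?d \<bullet> w \<le> 0" by (simp_all add: inner_perp)
    hence "\<forall>u\<in>nearest P x. ?d \<bullet> (u - p) \<le> 0" unfolding n by (simp add: v_def w_def)
    ultimately show False by (metis no_ascent)
  qed
  ultimately have "0 < a" "0 < b" by linarith+
  hence "\<exists>\<alpha>>0. \<exists>\<beta>>0. e = \<alpha> *\<^sub>R (s - p) + \<beta> *\<^sub>R (t - p)"
    using e' unfolding v_def w_def by auto
  hence "apex P p e x" unfolding apex_def using n s(2) t(2,3) by metis
  thus ?thesis ..
qed

text \<open>With respect to a direction \<open>u\<close> perpendicular to \<open>e\<close>, the corner at which \<open>e\<close> enters is the
  middle one.\<close>

lemma apex_between:
  assumes "apex P p e x" "u \<bullet> e = 0" "\<And>s t. s \<in> P \<Longrightarrow> t \<in> P \<Longrightarrow> s \<noteq> t \<Longrightarrow> u \<bullet> s \<noteq> u \<bullet> t"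
  obtains q r where "nearest P x = {p, q, r}" "u \<bullet> q < u \<bullet> p" "u \<bullet> p < u \<bullet> r"
proof -
  obtain q r \<alpha> \<beta> where n: "nearest P x = {p, q, r}" "p \<noteq> q" "p \<noteq> r"
    and ab: "0 < \<alpha>" "0 < \<beta>" "e = \<alpha> *\<^sub>R (q - p) + \<beta> *\<^sub>R (r - p)"
    using assms(1) by (auto simp: apex_def)
  have "p \<in> P" "q \<in> P" "r \<in> P" using n(1) nearest_subset[of P x] by auto
  hence ne: "u \<bullet> q \<noteq> u \<bullet> p" "u \<bullet> r \<noteq> u \<bullet> p" using assms(3) n(2,3) by auto
  have eq: "\<alpha> * (u \<bullet> q - u \<bullet> p) + \<beta> * (u \<bullet> r - u \<bullet> p) = 0"
    using assms(2) unfolding ab(3) by (simp add: inner_add_right inner_diff_right)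
  show ?thesis
  proof (cases "u \<bullet> q < u \<bullet> p")
    case True
    hence "\<alpha> * (u \<bullet> q - u \<bullet> p) < 0" using ab by (simp add: mult_pos_neg)
    hence "0 < \<beta> * (u \<bullet> r - u \<bullet> p)" using eq by simp
    thus ?thesis using that[of q r] n True ab by (simp add: zero_less_mult_iff)
  next
    case False
    hence "0 < u \<bullet> q - u \<bullet> p" using ne by simp
    hence "0 < \<alpha> * (u \<bullet> q - u \<bullet> p)" using ab by simp
    hence "\<beta> * (u \<bullet> r - u \<bullet> p) < 0" using eq by simp
    thus ?thesis using that[of r q] n \<open>0 < u \<bullet> q - u \<bullet> p\<close> ab
      by (simp add: mult_less_0_iff insert_commute)
  qed
qed

lemma apex_unique:
  assumes "apex P p (\<sigma> *\<^sub>R e) x" "apex P p' (\<sigma>' *\<^sub>R e) x" "\<sigma> \<in> {1, -1}" "\<sigma>' \<in> {1, -1}"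
    and "u \<bullet> e = 0" and gen: "\<And>s t. s \<in> P \<Longrightarrow> t \<in> P \<Longrightarrow> s \<noteq> t \<Longrightarrow> u \<bullet> s \<noteq> u \<bullet> t"
  shows "p = p'" "\<sigma> = \<sigma>'"
proof -
  obtain q r where n: "nearest P x = {p, q, r}" "u \<bullet> q < u \<bullet> p" "u \<bullet> p < u \<bullet> r"
    using apex_between[OF assms(1) _ gen] assms(5) by auto
  obtain q' r' where n': "nearest P x = {p', q', r'}" "u \<bullet> q' < u \<bullet> p'" "u \<bullet> p' < u \<bullet> r'"
    using apex_between[OF assms(2) _ gen] assms(5) by auto
  have "{p, q, r} = {p', q', r'}" using n(1) n'(1) by simp
  thus p: "p = p'" using n(2,3) n'(2,3) by (smt (verit) insert_iff singletonD)
  obtain s t \<alpha> \<beta> where s: "nearest P x = {p, s, t}" "p \<noteq> s" "p \<noteq> t" "s \<noteq> t"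
    "0 < \<alpha>" "0 < \<beta>" "\<sigma> *\<^sub>R e = \<alpha> *\<^sub>R (s - p) + \<beta> *\<^sub>R (t - p)"
    using assms(1) by (auto simp: apex_def)
  obtain \<alpha>' \<beta>' where s': "0 < \<alpha>'" "0 < \<beta>'" "\<sigma>' *\<^sub>R e = \<alpha>' *\<^sub>R (s - p) + \<beta>' *\<^sub>R (t - p)"
  proof -
    obtain s' t' \<gamma> \<delta> where t: "nearest P x = {p, s', t'}" "p \<noteq> s'" "p \<noteq> t'" "s' \<noteq> t'"
      "0 < \<gamma>" "0 < \<delta>" "\<sigma>' *\<^sub>R e = \<gamma> *\<^sub>R (s' - p) + \<delta> *\<^sub>R (t' - p)"
      using assms(2) p by (auto simp: apex_def)
    have "{p, s, t} = {p, s', t'}" using s(1) t(1) by simp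
    hence "s' = s \<and> t' = t \<or> s' = t \<and> t' = s" using s(2-4) t(2-4) by auto
    thus ?thesis using that[of \<gamma> \<delta>] that[of \<delta> \<gamma>] t(5-7) by (auto simp: add.commute)
  qed
  have D: "cross (s - p) (t - p) \<noteq> 0"
    using s(1-4) nearest_equidistant[of p P x] by (intro cocircular_not_collinear[of x]) simp_all
  show "\<sigma> = \<sigma>'"
  proof (rule ccontr)
    assume "\<sigma> \<noteq> \<sigma>'"
    hence "\<sigma> *\<^sub>R e + \<sigma>' *\<^sub>R e = 0" using assms(3,4) by auto
    hence "cross (\<sigma> *\<^sub>R e + \<sigma>' *\<^sub>R e) (t - p) = 0" by (simp add: cross_def)
    hence "(\<alpha> + \<alpha>') * cross (s - p) (t - p) = 0"
      unfolding s(7) s'(3) by (simp add: cross_def algebra_simps)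
    thus False using D s(5) s'(1) by simp
  qed
qed

text \<open>Among the directions \<open>(1, c)\<close>, each pair of distinct points excludes at most one \<open>c\<close>.\<close>

lemma generic_direction_exists:
  assumes "finite P"
  obtains u :: "real^2" where "u \<noteq> 0" "\<And>s t. s \<in> P \<Longrightarrow> t \<in> P \<Longrightarrow> s \<noteq> t \<Longrightarrow> u \<bullet> s \<noteq> u \<bullet> t"
proof -
  let ?bad = "(\<lambda>(s, t). - (s - t)$1 / (s - t)$2) ` (P \<times> P)"
  have "finite ?bad" using assms by simp
  then obtain c :: real where c: "c \<notin> ?bad"
    using ex_new_if_finite[OF infinite_UNIV_char_0] by blast
  let ?u = "vector [1, c] :: real^2"
  have "?u \<bullet> s \<noteq> ?u \<bullet> t" if st: "s \<in> P" "t \<in> P" "s \<noteq> t" for s t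
  proof
    assume "?u \<bullet> s = ?u \<bullet> t"
    hence eq: "(s - t)$1 + c * (s - t)$2 = 0" by (simp add: inner_plane algebra_simps)
    have "(s - t)$2 \<noteq> 0"
    proof
      assume "(s - t)$2 = 0"
      hence "s = t" using eq by (simp add: eq_plane)
      thus False using st by simp
    qed
    hence "c = - (s - t)$1 / (s - t)$2" using eq by (simp add: field_simps)
    thus False using c st by auto
  qed
  moreover have "?u \<noteq> 0" by (simp add: eq_plane)
  ultimately show ?thesis using that[of ?u] by blast
qed

text \<open>With \<open>l\<close> to the left and \<open>r\<close> to the right of the line through \<open>p\<close> perpendicular to \<open>u\<close>, this
  line meets the segment from \<open>l\<close> to \<open>r\<close>; the orientation of \<open>p\<close>, \<open>l\<close>, \<open>r\<close> tells on which side
  of \<open>p\<close>.\<close>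

lemma in_cone_of_two:
  assumes "l \<in> P" "r \<in> P" "u \<bullet> (l - p) < 0" "0 < u \<bullet> (r - p)" "\<sigma> * cross (l - p) (r - p) < 0"
  shows "in_cone P p (\<sigma> *\<^sub>R perp u)"
proof -
  define v w where "v = l - p" and "w = r - p"
  let ?a = "\<sigma> * - (u \<bullet> w) / cross v w" and ?b = "\<sigma> * (u \<bullet> v) / cross v w"
  have D: "cross v w \<noteq> 0" using assms(5) by (auto simp: v_def w_def)
  have "cross v w *\<^sub>R (\<sigma> *\<^sub>R perp u) = \<sigma> *\<^sub>R (cross (perp u) w *\<^sub>R v + cross v (perp u) *\<^sub>R w)"
    using cramer[of v w "perp u"] by (metis scaleR_left_commute)
  also have "\<dots> = cross v w *\<^sub>R (?a *\<^sub>R v + ?b *\<^sub>R w)"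
    using D cross_swap[of v "perp u"] by (simp add: cross_perp scaleR_add_right scaleR_diff_right)
  finally have "\<sigma> *\<^sub>R perp u = ?a *\<^sub>R v + ?b *\<^sub>R w" by (rule scaleR_left_imp_eq[OF D])
  moreover have "0 < ?a" "0 < ?b"
    using assms(3-5) unfolding v_def[symmetric] w_def[symmetric]
    by (auto simp: zero_less_divide_iff divide_less_0_iff mult_less_0_iff zero_less_mult_iff)
  ultimately show ?thesis
    unfolding in_cone_def v_def w_def using assms(1,2) by blast
qed

text \<open>If no segment passes above \<open>p\<close>, then the line from \<open>p\<close> to the point of steepest slope on the
  right has all of \<open>P\<close> on or below it, so that \<open>p\<close> is a boundary point.\<close>

lemma in_cone_above_if_not_Bd:
  assumes "finite P" "p \<in> P" "p \<notin> Bd P" "l \<in> P" "u \<bullet> (l - p) < 0" "r \<in> P" "0 < u \<bullet> (r - p)"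
    and gen: "\<And>s t. s \<in> P \<Longrightarrow> t \<in> P \<Longrightarrow> s \<noteq> t \<Longrightarrow> u \<bullet> s \<noteq> u \<bullet> t"
  shows "in_cone P p (perp u)"
proof (rule ccontr)
  assume not: "\<not> in_cone P p (perp u)"
  define R where "R = {s \<in> P. 0 < u \<bullet> (s - p)}"
  define slope where "slope s = cross u (s - p) / (u \<bullet> (s - p))" for s
  have "finite R" "R \<noteq> {}" using assms by (auto simp: R_def)
  then obtain m where m: "m \<in> R" "\<And>s. s \<in> R \<Longrightarrow> - slope m \<le> - slope s"
    using ex_is_arg_min_if_finite[of R "\<lambda>s. - slope s"] unfolding is_arg_min_linorder by metis
  have mR: "m \<in> P" "0 < u \<bullet> (m - p)" using m(1) by (auto simp: R_def)
  have uu: "0 < u \<bullet> u" using mR by (cases "u = 0") auto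
  have "p \<in> Bd P"
  proof (rule Bd_if_supported[OF assms(2)])
    show "perp (m - p) \<noteq> 0" using mR by auto
    show "perp (m - p) \<bullet> (s - p) \<le> 0" if s: "s \<in> P" for s
    proof -
      consider "s = p" | "u \<bullet> (s - p) < 0" | "0 < u \<bullet> (s - p)"
        using gen[OF s assms(2)] by (fastforce simp: inner_diff_right)
      thus ?thesis
      proof cases
        case 2
        have "\<not> 1 * cross (s - p) (m - p) < 0"
          using in_cone_of_two[OF s mR(1) 2 mR(2), of 1] not by auto
        thus ?thesis using cross_swap[of "s - p" "m - p"] by (simp add: inner_perp)
      next
        case 3
        hence "slope s \<le> slope m" using m(2) s by (simp add: R_def)
        hence "cross u (s - p) * (u \<bullet> (m - p)) \<le> cross u (m - p) * (u \<bullet> (s - p))"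
          using 3 mR(2) by (simp add: slope_def field_simps)
        moreover have "(u \<bullet> u) * cross (m - p) (s - p)
            = (u \<bullet> (m - p)) * cross u (s - p) - cross u (m - p) * (u \<bullet> (s - p))"
          unfolding plane_simps by algebra
        ultimately have "(u \<bullet> u) * cross (m - p) (s - p) \<le> 0" by (simp add: mult.commute)
        thus ?thesis using uu by (simp add: inner_perp mult_le_0_iff)
      qed simp
    qed
  qed
  thus False using assms(3) by blast
qed

text \<open>If no segment passes above or below \<open>p\<close>, then all of them pass through \<open>p\<close>, and \<open>P\<close> is
  contained in a line.\<close>

lemma in_cone_if_not_collinear:
  assumes "\<not> collinear P" "p \<in> P" "l \<in> P" "u \<bullet> (l - p) < 0" "r \<in> P" "0 < u \<bullet> (r - p)"
    and gen: "\<And>s t. s \<in> P \<Longrightarrow> t \<in> P \<Longrightarrow> s \<noteq> t \<Longrightarrow> u \<bullet> s \<noteq> u \<bullet> t"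
  shows "\<exists>\<sigma>\<in>{1, -1}. in_cone P p (\<sigma> *\<^sub>R perp u)"
proof (rule ccontr)
  assume not: "\<not> ?thesis"
  have zero: "cross (l - p) (r - p) = 0"
    if "l \<in> P" "u \<bullet> (l - p) < 0" "r \<in> P" "0 < u \<bullet> (r - p)" for l r
  proof -
    have "\<not> 1 * cross (l - p) (r - p) < 0" "\<not> (-1) * cross (l - p) (r - p) < 0"
      using in_cone_of_two[OF that(1,3,2,4), of 1] in_cone_of_two[OF that(1,3,2,4), of "-1"] not
      by auto
    thus ?thesis by simp
  qed
  have "l - p \<noteq> 0" "r \<noteq> p" using assms(4,6) by auto
  then obtain k where k: "r - p = k *\<^sub>R (l - p)"
    using cross_eq_0_imp_scaleR zero[OF assms(3-6)] by metis
  have "cross (r - p) (s - p) = 0" if s: "s \<in> P" for s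
  proof -
    consider "s = p" | "u \<bullet> (s - p) < 0" | "0 < u \<bullet> (s - p)"
      using gen[OF s assms(2)] by (fastforce simp: inner_diff_right)
    thus ?thesis
    proof cases
      case 2
      thus ?thesis using zero[OF s 2 assms(5,6)] cross_swap[of "r - p" "s - p"] by simp
    next
      case 3
      have "cross (r - p) (s - p) = k * cross (l - p) (s - p)"
        unfolding k by (simp add: cross_def algebra_simps)
      thus ?thesis using zero[OF assms(3,4) s 3] by simp
    qed (simp add: cross_def)
  qed
  hence "collinear P" using collinear_if_cross_0[OF \<open>r \<noteq> p\<close>] by blast
  thus False using assms(1) by blast
qed

text \<open>Count the pairs of a point and a side at which some triangle is entered; distinct pairs give
  distinct triangles. Every point contributes two, with a loss of at most one for each boundary
  point and of at most one more at each of the two points \<open>lo\<close> and \<open>hi\<close> extreme in direction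
  \<open>u\<close>.\<close>

lemma card_voronoi_iteration_ge:
  assumes "finite P" "\<not> collinear P" "cocircularity P = 0"
  shows "2 * card P \<le> card (voronoi_iteration P) + card (Bd P) + 2"
proof -
  obtain u where "u \<noteq> 0" and gen: "\<And>s t. s \<in> P \<Longrightarrow> t \<in> P \<Longrightarrow> s \<noteq> t \<Longrightarrow> u \<bullet> s \<noteq> u \<bullet> t"
    using generic_direction_exists[OF assms(1)] by metis
  have "P \<noteq> {}" using assms(2) by auto
  define lo where "lo = arg_min_on (\<lambda>s. u \<bullet> s) P"
  define hi where "hi = arg_min_on (\<lambda>s. - (u \<bullet> s)) P"
  have lo: "lo \<in> P" "\<And>s. s \<in> P \<Longrightarrow> u \<bullet> lo \<le> u \<bullet> s"
    and hi: "hi \<in> P" "\<And>s. s \<in> P \<Longrightarrow> u \<bullet> s \<le> u \<bullet> hi"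
    using arg_min_if_finite[OF assms(1) \<open>P \<noteq> {}\<close>, of "\<lambda>s. u \<bullet> s"]
      arg_min_if_finite[OF assms(1) \<open>P \<noteq> {}\<close>, of "\<lambda>s. - (u \<bullet> s)"]
    by (auto simp: lo_def hi_def not_less)
  have Bd: "lo \<in> Bd P" "hi \<in> Bd P"
    using \<open>u \<noteq> 0\<close> lo hi Bd_if_supported[of lo P "- u"] Bd_if_supported[of hi P u]
    by (auto simp: inner_diff_right)
  define S where "S p = {\<sigma> \<in> {1, -1 :: real}. in_cone P p (\<sigma> *\<^sub>R perp u)}" for p
  define Z where "Z = Sigma P S"
  have fin: "finite (S p)" for p by (simp add: S_def)
  have "\<exists>x. apex P p (\<sigma> *\<^sub>R perp u) x" if "(p, \<sigma>) \<in> Z" for p \<sigma>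
  proof (rule apex_exists[OF assms(1,3)])
    show p: "p \<in> P" "in_cone P p (\<sigma> *\<^sub>R perp u)" using that by (auto simp: Z_def S_def)
    have "\<sigma> \<noteq> 0" using that by (auto simp: Z_def S_def)
    thus "\<sigma> *\<^sub>R perp u \<noteq> 0" using \<open>u \<noteq> 0\<close> by simp
    show "cross (\<sigma> *\<^sub>R perp u) (s - p) \<noteq> 0" if "s \<in> P" "s \<noteq> p" for s
    proof -
      have "cross (\<sigma> *\<^sub>R perp u) (s - p) = - \<sigma> * (u \<bullet> s - u \<bullet> p)"
        by (simp add: plane_simps algebra_simps)
      thus ?thesis using gen[OF that(1) p(1) that(2)] \<open>\<sigma> \<noteq> 0\<close> by simp
    qed
  qed
  hence "\<forall>z\<in>Z. \<exists>x. apex P (fst z) (snd z *\<^sub>R perp u) x" by auto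
  then obtain f where "\<forall>z\<in>Z. apex P (fst z) (snd z *\<^sub>R perp u) (f z)" by metis
  hence f: "apex P p (\<sigma> *\<^sub>R perp u) (f (p, \<sigma>))" if "(p, \<sigma>) \<in> Z" for p \<sigma>
    using that by fastforce
  have "card Z \<le> card (voronoi_iteration P)"
  proof (rule card_inj_on_le)
    show "inj_on f Z"
    proof (rule inj_onI, clarify)
      fix p \<sigma> p' \<sigma>' assume Z: "(p, \<sigma>) \<in> Z" "(p', \<sigma>') \<in> Z" and "f (p, \<sigma>) = f (p', \<sigma>')"
      hence "apex P p (\<sigma> *\<^sub>R perp u) (f (p, \<sigma>))" "apex P p' (\<sigma>' *\<^sub>R perp u) (f (p, \<sigma>))"
        using f[OF Z(1)] f[OF Z(2)] by simp_all
      moreover have "\<sigma> \<in> {1, -1}" "\<sigma>' \<in> {1, -1}" using Z by (auto simp: Z_def S_def)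
      moreover have "u \<bullet> perp u = 0" by (simp add: inner_plane)
      ultimately show "p = p' \<and> \<sigma> = \<sigma>'" using apex_unique gen by metis
    qed
    show "f ` Z \<subseteq> voronoi_iteration P"
    proof clarify
      fix p \<sigma> assume "(p, \<sigma>) \<in> Z"
      hence "card (nearest P (f (p, \<sigma>))) = 3" using f by (fastforce simp: apex_def)
      thus "f (p, \<sigma>) \<in> voronoi_iteration P" using voronoi_iteration_eq[OF assms(1)] by simp
    qed
  qed (use assms(1) finite_voronoi_iteration in simp)
  moreover have "card Z = (\<Sum>p\<in>P. card (S p))" using assms(1) fin by (simp add: Z_def)
  moreover have "2 \<le> card (S p) + of_bool (p \<in> Bd P) + of_bool (p = lo) + of_bool (p = hi)"
    if p: "p \<in> P" for p
  proof (cases "p = lo \<or> p = hi")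
    case True
    thus ?thesis using Bd by auto
  next
    case False
    have l: "u \<bullet> (lo - p) < 0" and r: "0 < u \<bullet> (hi - p)"
      using gen[OF lo(1) p] gen[OF hi(1) p] lo(2)[OF p] hi(2)[OF p] False
      by (auto simp: inner_diff_right)
    show ?thesis
    proof (cases "p \<in> Bd P")
      case True
      obtain \<sigma> where "\<sigma> \<in> {1, -1}" "in_cone P p (\<sigma> *\<^sub>R perp u)"
        using in_cone_if_not_collinear[OF assms(2) p lo(1) l hi(1) r gen] by (rule bexE)
      hence "\<sigma> \<in> S p" by (simp add: S_def)
      hence "card (S p) \<noteq> 0" using fin by auto
      thus ?thesis using True by simp
    next
      case False
      have "in_cone P p (perp u)"
        by (rule in_cone_above_if_not_Bd[OF assms(1) p False lo(1) l hi(1) r gen])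
      moreover have "in_cone P p (perp (- u))"
        by (rule in_cone_above_if_not_Bd[OF assms(1) p False hi(1) _ lo(1)])
           (use l r gen in auto)
      moreover have "perp (- u) = - perp u" by (simp add: eq_plane)
      ultimately have "S p = {1, -1}" by (auto simp: S_def)
      thus ?thesis by simp
    qed
  qed
  hence "(\<Sum>p\<in>P. 2) \<le> (\<Sum>p\<in>P. card (S p) + of_bool (p \<in> Bd P) + of_bool (p = lo) + of_bool (p = hi))"
    by (rule sum_mono)
  moreover have "(\<Sum>p\<in>P. of_bool (p \<in> Bd P)) = card (Bd P)"
    using assms(1) by (simp add: Bd_def of_bool_def flip: sum.inter_filter) (simp add: Int_def)
  moreover have "(\<Sum>p\<in>P. of_bool (p = lo)) = (1::nat)" "(\<Sum>p\<in>P. of_bool (p = hi)) = (1::nat)"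
    using assms(1) lo(1) hi(1) by (simp_all add: of_bool_def)
  ultimately show ?thesis by (simp add: sum.distrib)
qed

section \<open>Iterating the bounds\<close>

theorem theorem3:
  fixes P :: "(real^2) set" and N :: nat
  assumes "finite P"
    and "3 \<le> card P \<Longrightarrow> \<not> collinear P"
    and "\<And>n. n < N \<Longrightarrow> cocircularity ((voronoi_iteration ^^ n) P) = 0"
  shows "int (card ((voronoi_iteration ^^ N) P))
    \<ge> 2 ^ N * int (card P) - (2 ^ N - 1) * (int (card (Bd P)) + 2)"
proof -
  define V where "V n = (voronoi_iteration ^^ n) P" for n
  have V0: "V 0 = P" and VSuc: "V (Suc n) = voronoi_iteration (V n)" for n by (simp_all add: V_def)
  have coc: "cocircularity (V n) = 0" if "n < N" for n using assms(3)[OF that] by (simp add: V_def)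
  have fin: "finite (V n)" for n
    by (induction n) (simp_all add: V0 VSuc assms(1) finite_voronoi_iteration)
  have Bd: "card (Bd (V n)) \<le> card (Bd P)" if "n \<le> N" for n
    using that
  proof (induction n)
    case (Suc n)
    thus ?case using card_Bd_voronoi_iteration_le[OF fin coc, of n] by (simp add: VSuc)
  qed (simp add: V0)
  have step: "2 * card (V n) \<le> card (V (Suc n)) + card (Bd P) + 2" if "n < N" for n
  proof (cases "collinear (V n)")
    case False
    thus ?thesis using card_voronoi_iteration_ge[OF fin False coc[OF that]] Bd[of n] that
      by (simp add: VSuc)
  next
    case True
    show ?thesis
    proof (cases n)
      case 0
      hence "collinear P" using True by (simp add: V0)
      hence "card P \<le> 2" using assms(2) by (cases "3 \<le> card P") auto
      moreover have "Bd P = P" using \<open>collinear P\<close> by (rule collinear_imp_Bd_eq)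
      ultimately show ?thesis using 0 by (simp add: V0)
    next
      case (Suc m)
      have "2 * card (V n) \<le> card (Bd (V m))"
        using card_collinear_voronoi_iteration_le[OF fin coc, of m] True that Suc by (simp add: VSuc)
      thus ?thesis using Bd[of m] that Suc by simp
    qed
  qed
  define c where "c = int (card (Bd P)) + 2"
  have "2 ^ n * (int (card P) - c) \<le> int (card (V n)) - c" if "n \<le> N" for n
    using that
  proof (induction n)
    case (Suc n)
    have "2 * int (card (V n)) \<le> int (card (V (Suc n))) + c"
      using step[of n] Suc.prems by (simp add: c_def)
    moreover have "2 ^ n * (int (card P) - c) \<le> int (card (V n)) - c" using Suc by simp
    ultimately show ?case by simp
  qed (simp add: V0)
  from this[of N] show ?thesis by (simp add: V_def c_def algebra_simps)
qed

end
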